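(* $\mathcal{J}_p$ is a two-sided ideal of $(\beta\mathbb{N},+)$.
   Context: $(\beta\mathbb{N},+)$ is the semigroup of ultrafilters on $\mathbb{N}$ with $A\in p+q$ iff $\{x\in\mathbb{N}:-x+A\in q\}\in p$, where $-x+A=\{y:x+y\in A\}$. $\mathbb{P}$ denotes the set of polynomials with integer coefficients which vanish at $0$ and map $\mathbb{N}$ into $\mathbb{N}$. An IP-set is a family $(x_\alpha)_\alpha$ indexed by nonempty finite $\alpha\subseteq\mathbb{N}$ with $x_\alpha=\sum_{t\in\alpha}x_t$ for some sequence $(x_n)$ in $\mathbb{N}$. $A\subseteq\mathbb{N}$ is a $J_p$-set if for every finite $F\subseteq\mathbb{P}$, every $l\in\mathbb{N}$ and all IP-sets $(x^i_\alpha)_\alpha$, $i=1,\dots,l$, there exist $a\in\mathbb{N}\cup\{0\}$ and nonempty finite $\beta\subseteq\mathbb{N}$ with $a+P(x^i_\beta)\in A$ for all $P\in F$, $i\le l$. $\mathcal{J}_p=\{p\in\beta\mathbb{N}: \text{every } A\in p \text{ is a } J_p\text{-set}\}$. *)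

theory Defs
  imports "HOL-Computational_Algebra.Polynomial"
begin

(* The natural numbers of the source start at 1, whereas the type nat contains 0.
   Subsets of \<nat>, ultrafilters on \<nat> and index sets are therefore relativised to
   the following carrier. *)
definition pnat :: "nat set" where
  "pnat = {1..}"

definition ultrafilter_on :: "'a set \<Rightarrow> 'a set set \<Rightarrow> bool" where
  "ultrafilter_on X U \<longleftrightarrow>
     U \<subseteq> Pow X \<and> X \<in> U \<and> {} \<notin> U \<and>
     (\<forall>A\<in>U. \<forall>B\<in>U. A \<inter> B \<in> U) \<and>
     (\<forall>A\<in>U. \<forall>B. A \<subseteq> B \<and> B \<subseteq> X \<longrightarrow> B \<in> U) \<and>
     (\<forall>A. A \<subseteq> X \<longrightarrow> A \<in> U \<or> X - A \<in> U)"

definition betaN :: "nat set set set" where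
  "betaN = {p. ultrafilter_on pnat p}"

(* The set written -x + A in the source. *)
definition shift_back :: "nat \<Rightarrow> nat set \<Rightarrow> nat set" where
  "shift_back x A = {y \<in> pnat. x + y \<in> A}"

definition beta_add :: "nat set set \<Rightarrow> nat set set \<Rightarrow> nat set set" where
  "beta_add p q = {A. A \<subseteq> pnat \<and> {x \<in> pnat. shift_back x A \<in> q} \<in> p}"

(* As usual in semigroup theory, ideals are nonempty. *)
definition two_sided_ideal :: "'a set \<Rightarrow> ('a \<Rightarrow> 'a \<Rightarrow> 'a) \<Rightarrow> 'a set \<Rightarrow> bool" where
  "two_sided_ideal S f I \<longleftrightarrow>
     I \<noteq> {} \<and> I \<subseteq> S \<and> (\<forall>s\<in>S. \<forall>i\<in>I. f s i \<in> I \<and> f i s \<in> I)"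

definition PP :: "int poly set" where
  "PP = {P. poly P 0 = 0 \<and> (\<forall>n\<in>pnat. poly P (int n) \<in> int ` pnat)}"

definition fin_index_sets :: "nat set set" where
  "fin_index_sets = {\<alpha>. finite \<alpha> \<and> \<alpha> \<noteq> {} \<and> \<alpha> \<subseteq> pnat}"

(* An IP-set is a family indexed by the members of fin_index_sets; the values of X at other
   sets are irrelevant. *)
definition IP_set :: "(nat set \<Rightarrow> nat) \<Rightarrow> bool" where
  "IP_set X \<longleftrightarrow>
     (\<exists>x. (\<forall>n\<in>pnat. x n \<in> pnat) \<and> (\<forall>\<alpha>\<in>fin_index_sets. X \<alpha> = (\<Sum>t\<in>\<alpha>. x t)))"

(* The shift a ranges over all of the type nat, i.e. a = 0 is allowed. *)
definition Jp_set :: "nat set \<Rightarrow> bool" where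
  "Jp_set A \<longleftrightarrow>
     A \<subseteq> pnat \<and>
     (\<forall>F l X. finite F \<and> F \<subseteq> PP \<and> l \<in> pnat \<and> (\<forall>i\<in>{1..l}. IP_set (X i)) \<longrightarrow>
        (\<exists>a::nat. \<exists>\<beta>\<in>fin_index_sets. \<forall>P\<in>F. \<forall>i\<in>{1..l::nat}.
           int a + poly P (int (X i \<beta>)) \<in> int ` A))"

definition Jp :: "nat set set set" where
  "Jp = {p \<in> betaN. \<forall>A\<in>p. Jp_set A}"

lemma shift_back_subset: "shift_back x A \<subseteq> pnat"
  by (auto simp: shift_back_def)

lemma beta_add_closed:
  assumes "p \<in> betaN" "q \<in> betaN"
  shows "beta_add p q \<in> betaN"
proof -
  have p: "ultrafilter_on pnat p" and q: "ultrafilter_on pnat q"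
    using assms by (auto simp: betaN_def)
  let ?S = "\<lambda>A. {x \<in> pnat. shift_back x A \<in> q}"
  note pD = p[unfolded ultrafilter_on_def] and qD = q[unfolded ultrafilter_on_def]
  have up_p: "B \<in> p" if "A \<subseteq> B" "A \<in> p" "B \<subseteq> pnat" for A B
    using pD that by metis
  have int_p: "A \<inter> B \<in> p" if "A \<in> p" "B \<in> p" for A B
    using pD that by metis
  have dich_p: "A \<in> p \<or> pnat - A \<in> p" if "A \<subseteq> pnat" for A
    using pD that by metis
  have up_q: "B \<in> q" if "A \<subseteq> B" "A \<in> q" "B \<subseteq> pnat" for A B
    using qD that by metis
  have int_q: "A \<inter> B \<in> q" if "A \<in> q" "B \<in> q" for A B
    using qD that by metis
  have dich_q: "A \<in> q \<or> pnat - A \<in> q" if "A \<subseteq> pnat" for A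
    using qD that by metis
  have top: "pnat \<in> p" "pnat \<in> q" and bot: "{} \<notin> p" "{} \<notin> q"
    using pD qD by simp_all
  have sub: "?S A \<subseteq> pnat" for A by auto
  have "shift_back x pnat = pnat" for x
    by (auto simp: shift_back_def pnat_def)
  then have 1: "pnat \<in> beta_add p q"
    using top by (simp add: beta_add_def)
  have "shift_back x {} = {}" for x
    by (auto simp: shift_back_def)
  then have 2: "{} \<notin> beta_add p q"
    using bot by (simp add: beta_add_def)
  have 3: "A \<inter> B \<in> beta_add p q" if "A \<in> beta_add p q" "B \<in> beta_add p q" for A B
  proof -
    have "shift_back x (A \<inter> B) = shift_back x A \<inter> shift_back x B" for x
      by (auto simp: shift_back_def)
    then have "?S A \<inter> ?S B \<subseteq> ?S (A \<inter> B)"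
      using int_q by auto
    moreover have "?S A \<inter> ?S B \<in> p"
      using that int_p by (simp add: beta_add_def)
    ultimately have "?S (A \<inter> B) \<in> p"
      by (rule up_p[OF _ _ sub])
    then show ?thesis
      using that by (auto simp: beta_add_def)
  qed
  have 4: "B \<in> beta_add p q" if "A \<in> beta_add p q" "A \<subseteq> B" "B \<subseteq> pnat" for A B
  proof -
    have "shift_back x A \<subseteq> shift_back x B" for x
      using that(2) by (auto simp: shift_back_def)
    from up_q[OF this _ shift_back_subset] have "?S A \<subseteq> ?S B"
      by auto
    moreover have "?S A \<in> p"
      using that by (simp add: beta_add_def)
    ultimately have "?S B \<in> p"
      by (rule up_p[OF _ _ sub])
    then show ?thesis
      using that by (simp add: beta_add_def)
  qed
  have 5: "A \<in> beta_add p q \<or> pnat - A \<in> beta_add p q" if "A \<subseteq> pnat" for A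
  proof -
    have "shift_back x (pnat - A) = pnat - shift_back x A" for x
      by (auto simp: shift_back_def pnat_def)
    then have "pnat - ?S A \<subseteq> ?S (pnat - A)"
      using dich_q[OF shift_back_subset] by auto
    from up_p[OF this _ sub] have "?S A \<in> p \<or> ?S (pnat - A) \<in> p"
      using dich_p[OF sub] by blast
    then show ?thesis
      using that by (auto simp: beta_add_def)
  qed
  have "beta_add p q \<subseteq> Pow pnat"
    by (auto simp: beta_add_def)
  then show ?thesis
    unfolding betaN_def ultrafilter_on_def mem_Collect_eq using 1 2 3 4 5
    by (intro conjI ballI allI impI) (assumption | metis)+
qed

lemma beta_add_assoc:
  assumes "p \<in> betaN" "q \<in> betaN" "r \<in> betaN"
  shows "beta_add (beta_add p q) r = beta_add p (beta_add q r)"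
proof -
  have "shift_back x {z \<in> pnat. shift_back z A \<in> r}
      = {y \<in> pnat. shift_back y (shift_back x A) \<in> r}" if "x \<in> pnat" for x A
  proof -
    have "shift_back (x + y) A = shift_back y (shift_back x A)" if "y \<in> pnat" for y
      using \<open>x \<in> pnat\<close> that by (auto simp: shift_back_def pnat_def add.assoc)
    moreover have "x + y \<in> pnat" if "y \<in> pnat" for y
      using that by (auto simp: pnat_def)
    ultimately show ?thesis
      by (auto simp: shift_back_def[of x "{z \<in> pnat. shift_back z A \<in> r}"])
  qed
  then have "{x \<in> pnat. shift_back x {z \<in> pnat. shift_back z A \<in> r} \<in> q}
      = {x \<in> pnat. shift_back x A \<in> beta_add q r}" for A
    using shift_back_subset by (auto simp: beta_add_def)
  then show ?thesis
    unfolding beta_add_def[of p] beta_add_def[of _ r] by (auto simp: beta_add_def)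
qed

end

theory Submission
  imports Defs "HOL-Library.Multiset" "HOL-Library.FuncSet"
begin

text \<open>
  The ideal property is a direct computation with the definition of \<open>p + q\<close>. Nonemptiness amounts
  to the statement that no finite colouring of the positive integers has only colour classes that
  fail to be \<open>J\<^sub>p\<close>-sets, that is, to the polynomial van der Waerden theorem along IP-sets. This is
  shown by colour focusing, in Walters' form, for all polynomial maps \<open>v\<close> from finite index sets to
  the integers. Focusing reduces a family of maps \<open>v\<close> to the maps
  \<open>v (\<alpha> \<union> \<gamma>) - v \<gamma> - u \<alpha>\<close>, where \<open>u\<close> is a leading part of minimal degree in the family; this
  replaces the leading part \<open>u\<close> by finitely many of smaller degree, so the multiset of degrees of
  the leading parts decreases.
\<close>

section \<open>Polynomial maps on finite index sets\<close>

text \<open>Maps \<open>v\<close> are only looked at on the finite subsets of a tail \<open>{n..}\<close>. Since \<open>\<gamma> = {}\<close> is allowed,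
  a polynomial map vanishes at the empty set.\<close>

primrec poly_map :: "nat \<Rightarrow> nat \<Rightarrow> (nat set \<Rightarrow> int) \<Rightarrow> bool" where
  "poly_map 0 n v \<longleftrightarrow> (\<forall>\<alpha>. finite \<alpha> \<and> \<alpha> \<subseteq> {n..} \<longrightarrow> v \<alpha> = 0)"
| "poly_map (Suc d) n v \<longleftrightarrow>
     (\<forall>\<gamma> m. \<gamma> \<subseteq> {n..<m} \<and> n \<le> m \<longrightarrow> poly_map d m (\<lambda>\<alpha>. v (\<alpha> \<union> \<gamma>) - v \<alpha> - v \<gamma>))"

lemma poly_map_tail: "poly_map d n v \<Longrightarrow> n \<le> m \<Longrightarrow> poly_map d m v"
proof (induction d arbitrary: n m v)
  case 0
  have "{m..} \<subseteq> {n..}"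
    using 0 by simp
  then show ?case
    using 0 by (meson order_trans poly_map.simps(1))
next
  case (Suc d)
  have "\<gamma> \<subseteq> {n..<k} \<and> n \<le> k" if "\<gamma> \<subseteq> {m..<k}" "m \<le> k" for \<gamma> k
    using that Suc.prems(2) by auto
  then show ?case
    using Suc.prems(1) by auto
qed

text \<open>Lets a map be replaced by one that agrees with it on finite subsets of the tail only.
  This is needed for identities that hold only when \<open>\<alpha>\<close> lies beyond
  \<open>\<gamma>\<close>.\<close>

lemma poly_map_cong:
  assumes "\<And>\<alpha>. finite \<alpha> \<Longrightarrow> \<alpha> \<subseteq> {n..} \<Longrightarrow> v \<alpha> = w \<alpha>"
  shows "poly_map d n v \<longleftrightarrow> poly_map d n w"
  using assms
proof (induction d arbitrary: n v w)
  case (Suc d)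
  have "poly_map d m (\<lambda>\<alpha>. v (\<alpha> \<union> \<gamma>) - v \<alpha> - v \<gamma>) \<longleftrightarrow> poly_map d m (\<lambda>\<alpha>. w (\<alpha> \<union> \<gamma>) - w \<alpha> - w \<gamma>)"
    if "\<gamma> \<subseteq> {n..<m} \<and> n \<le> m" for \<gamma> m
  proof (rule Suc.IH)
    fix \<alpha> :: "nat set" assume "finite \<alpha>" "\<alpha> \<subseteq> {m..}"
    moreover have "finite \<gamma>" "\<gamma> \<subseteq> {n..}"
      using that finite_subset[of \<gamma> "{n..<m}"] by auto
    moreover have "\<alpha> \<subseteq> {n..}"
      using that \<open>\<alpha> \<subseteq> {m..}\<close> by auto
    ultimately show "v (\<alpha> \<union> \<gamma>) - v \<alpha> - v \<gamma> = w (\<alpha> \<union> \<gamma>) - w \<alpha> - w \<gamma>"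
      using Suc.prems by simp
  qed
  then show ?case by auto
qed auto

lemma poly_map_empty: "poly_map d n v \<Longrightarrow> v {} = 0"
proof (induction d arbitrary: n v)
  case (Suc d)
  then have "poly_map d n (\<lambda>\<alpha>. v (\<alpha> \<union> {}) - v \<alpha> - v {})"
    unfolding poly_map.simps by blast
  from Suc.IH[OF this] show ?case
    by simp
qed simp

lemma poly_map_zero: "poly_map d n (\<lambda>\<alpha>. 0)"
  by (induction d arbitrary: n) auto

lemma poly_map_add:
  "poly_map d n v \<Longrightarrow> poly_map d n w \<Longrightarrow> poly_map d n (\<lambda>\<alpha>. v \<alpha> + w \<alpha>)"
proof (induction d arbitrary: n v w)
  case (Suc d)
  have "poly_map d m (\<lambda>\<alpha>. (v (\<alpha> \<union> \<gamma>) + w (\<alpha> \<union> \<gamma>)) - (v \<alpha> + w \<alpha>) - (v \<gamma> + w \<gamma>))"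
    if "\<gamma> \<subseteq> {n..<m} \<and> n \<le> m" for \<gamma> m
  proof -
    have "poly_map d m (\<lambda>\<alpha>. v (\<alpha> \<union> \<gamma>) - v \<alpha> - v \<gamma>)" "poly_map d m (\<lambda>\<alpha>. w (\<alpha> \<union> \<gamma>) - w \<alpha> - w \<gamma>)"
      using Suc.prems that unfolding poly_map.simps by blast+
    from Suc.IH[OF this] show ?thesis
      by (simp add: algebra_simps)
  qed
  then show ?case by simp
qed simp

lemma poly_map_uminus: "poly_map d n v \<Longrightarrow> poly_map d n (\<lambda>\<alpha>. - v \<alpha>)"
proof (induction d arbitrary: n v)
  case (Suc d)
  have "poly_map d m (\<lambda>\<alpha>. - v (\<alpha> \<union> \<gamma>) - - v \<alpha> - - v \<gamma>)" if "\<gamma> \<subseteq> {n..<m} \<and> n \<le> m" for \<gamma> m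
  proof -
    have "poly_map d m (\<lambda>\<alpha>. v (\<alpha> \<union> \<gamma>) - v \<alpha> - v \<gamma>)"
      using Suc.prems that unfolding poly_map.simps by blast
    from Suc.IH[OF this] show ?thesis
      by (simp add: algebra_simps)
  qed
  then show ?case by simp
qed simp

lemma poly_map_diff:
  "poly_map d n v \<Longrightarrow> poly_map d n w \<Longrightarrow> poly_map d n (\<lambda>\<alpha>. v \<alpha> - w \<alpha>)"
  using poly_map_add[OF _ poly_map_uminus, of d n v w] by simp

lemma poly_map_Suc: "poly_map d n v \<Longrightarrow> poly_map (Suc d) n v"
proof (induction d arbitrary: n v)
  case 0
  have "v (\<alpha> \<union> \<gamma>) - v \<alpha> - v \<gamma> = 0" if "\<gamma> \<subseteq> {n..<m}" "n \<le> m" "finite \<alpha>" "\<alpha> \<subseteq> {m..}" for \<gamma> m \<alpha>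
  proof -
    have "finite \<gamma>" "\<gamma> \<subseteq> {n..}" "\<alpha> \<subseteq> {n..}"
      using that finite_subset[of \<gamma> "{n..<m}"] by auto
    then show ?thesis
      using 0 \<open>finite \<alpha>\<close> by simp
  qed
  then show ?case
    unfolding poly_map.simps by blast
next
  case (Suc d)
  have "poly_map (Suc d) m (\<lambda>\<alpha>. v (\<alpha> \<union> \<gamma>) - v \<alpha> - v \<gamma>)" if "\<gamma> \<subseteq> {n..<m} \<and> n \<le> m" for \<gamma> m
    using Suc.prems that by (intro Suc.IH) (simp only: poly_map.simps)
  then show ?case
    unfolding poly_map.simps(2)[of "Suc d"] by blast
qed

lemma poly_map_mono: "poly_map d n v \<Longrightarrow> d \<le> e \<Longrightarrow> poly_map e n v"
  by (rule dec_induct[of d e "\<lambda>e. poly_map e n v"]) (simp_all only: poly_map_Suc)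

section \<open>Integer polynomials along finite sums\<close>

text \<open>Composition with the monic linear polynomial \<open>[:g, 1:]\<close> keeps degree and
  leading coefficient, so the top terms cancel. The constant \<open>c\<close> does not interfere
  because the degree is positive.\<close>

lemma degree_pcompose_shift_diff_less:
  fixes P :: "'a :: idom poly"
  assumes "degree P > 0"
  shows "degree (pcompose P [:g, 1:] - P - [:c:]) < degree P"
proof -
  let ?R = "pcompose P [:g, 1:] - P - [:c:]"
  have deg: "degree (pcompose P [:g, 1:]) = degree P"
    by (simp add: degree_pcompose)
  have lc: "lead_coeff (pcompose P [:g, 1:]) = lead_coeff P"
    using lead_coeff_comp[of "[:g, 1:]" P] by simp
  have "coeff [:c:] (degree P) = 0"
    using assms by (cases "degree P") auto
  then have "coeff ?R (degree P) = 0"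
    using lc deg by simp
  moreover have "degree ?R \<le> degree P"
    using deg by (intro degree_diff_le) auto
  ultimately show ?thesis
    using assms by (metis degree_0 eq_zero_or_degree_less)
qed

text \<open>For \<open>\<alpha>\<close> beyond \<open>\<gamma>\<close> the sums add up, so the
  difference along \<open>\<gamma>\<close> is again a polynomial \<open>R\<close> in
  \<open>sum x \<alpha>\<close>, of smaller degree and with value 0 at 0. This brings polynomials
  along IP-sets under the notion of polynomial map.\<close>

lemma poly_map_poly_sum:
  fixes x :: "nat \<Rightarrow> int"
  assumes "degree P \<le> d" "poly P 0 = 0"
  shows "poly_map d n (\<lambda>\<alpha>. poly P (sum x \<alpha>))"
  using assms
proof (induction d arbitrary: P n)
  case 0
  then have "P = 0"
    by (auto elim!: degree_eq_zeroE)
  then show ?case by simp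
next
  case (Suc d)
  show ?case
  proof (cases "degree P = 0")
    case True
    then have "P = 0"
      using Suc.prems by (auto elim!: degree_eq_zeroE)
    then show ?thesis
      using poly_map_zero by (simp del: poly_map.simps)
  next
    case False
    have "poly_map d m (\<lambda>\<alpha>. poly P (sum x (\<alpha> \<union> \<gamma>)) - poly P (sum x \<alpha>) - poly P (sum x \<gamma>))"
      if \<gamma>: "\<gamma> \<subseteq> {n..<m} \<and> n \<le> m" for \<gamma> m
    proof -
      define g where "g = sum x \<gamma>"
      define R where "R = pcompose P [:g, 1:] - P - [:poly P g:]"
      have "degree R < degree P"
        unfolding R_def using False by (intro degree_pcompose_shift_diff_less) simp
      moreover have "poly R 0 = 0"
        using Suc.prems by (simp add: R_def poly_pcompose)
      ultimately have R: "poly_map d m (\<lambda>\<alpha>. poly R (sum x \<alpha>))"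
        using Suc.prems by (intro Suc.IH) auto
      have eq: "poly P (sum x (\<alpha> \<union> \<gamma>)) - poly P (sum x \<alpha>) - poly P (sum x \<gamma>) = poly R (sum x \<alpha>)"
        if "finite \<alpha>" "\<alpha> \<subseteq> {m..}" for \<alpha>
      proof -
        have "finite \<gamma>" "\<alpha> \<inter> \<gamma> = {}"
          using \<gamma> that finite_subset[of \<gamma> "{n..<m}"] by fastforce+
        then have "sum x (\<alpha> \<union> \<gamma>) = g + sum x \<alpha>"
          using that by (simp add: sum.union_disjoint g_def)
        then show ?thesis
          by (simp add: R_def poly_pcompose g_def)
      qed
      show ?thesis
        using R by (subst poly_map_cong[OF eq])
    qed
    then show ?thesis by simp
  qed
qed

section \<open>Polynomial recurrence\<close>

text \<open>Taking \<open>a\<close> and \<open>\<beta>\<close> from finite sets that depend only on the number of colours makes it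
  possible to apply recurrence to colourings by patterns, and to translate windows of the integers
  into the positive integers.\<close>

definition recurrent :: "(nat set \<Rightarrow> int) set \<Rightarrow> nat \<Rightarrow> bool" where
  "recurrent V n \<longleftrightarrow>
     (\<forall>r. \<exists>A B. finite A \<and> finite B \<and> (\<forall>\<beta>\<in>B. finite \<beta> \<and> \<beta> \<noteq> {} \<and> \<beta> \<subseteq> {n..}) \<and>
        (\<forall>\<chi>::int \<Rightarrow> nat. range \<chi> \<subseteq> {..<r} \<longrightarrow> (\<exists>a\<in>A. \<exists>\<beta>\<in>B. \<forall>v\<in>V. \<chi> (a + v \<beta>) = \<chi> a)))"

lemma recurrentE:
  assumes "recurrent V n"
  obtains A B where "finite A" "finite B"
    "\<And>\<beta>. \<beta> \<in> B \<Longrightarrow> finite \<beta> \<and> \<beta> \<noteq> {} \<and> \<beta> \<subseteq> {n..}"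
    "\<And>\<chi>::int \<Rightarrow> nat. range \<chi> \<subseteq> {..<r} \<Longrightarrow> \<exists>a\<in>A. \<exists>\<beta>\<in>B. \<forall>v\<in>V. \<chi> (a + v \<beta>) = \<chi> a"
proof -
  from assms[unfolded recurrent_def, rule_format, of r] obtain A B where
    "finite A \<and> finite B \<and> (\<forall>\<beta>\<in>B. finite \<beta> \<and> \<beta> \<noteq> {} \<and> \<beta> \<subseteq> {n..}) \<and>
        (\<forall>\<chi>::int \<Rightarrow> nat. range \<chi> \<subseteq> {..<r} \<longrightarrow> (\<exists>a\<in>A. \<exists>\<beta>\<in>B. \<forall>v\<in>V. \<chi> (a + v \<beta>) = \<chi> a))"
    by blast
  then show thesis
    using that[of A B] by blast
qed

text \<open>Colour each integer \<open>x\<close> by the pattern of \<open>\<chi>\<close> on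
  \<open>x + T\<close>. There are finitely many patterns, so recurrence for their number
  \<open>s\<close> applies, and the resulting \<open>A\<close> and \<open>B\<close> do not depend on
  \<open>\<chi>\<close>.\<close>

lemma recurrent_patterns:
  assumes "recurrent V n" and "finite T"
  obtains A B where "finite A" "finite B"
    "\<And>\<beta>. \<beta> \<in> B \<Longrightarrow> finite \<beta> \<and> \<beta> \<noteq> {} \<and> \<beta> \<subseteq> {n..}"
    "\<And>\<chi>::int \<Rightarrow> nat. range \<chi> \<subseteq> {..<r} \<Longrightarrow>
       \<exists>a\<in>A. \<exists>\<beta>\<in>B. \<forall>v\<in>V. \<forall>t\<in>T. \<chi> (a + v \<beta> + t) = \<chi> (a + t)"
proof -
  let ?E = "T \<rightarrow>\<^sub>E {..<r}"
  have "finite ?E"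
    using assms(2) by (simp add: finite_PiE)
  then obtain code :: "(int \<Rightarrow> nat) \<Rightarrow> nat" and s where
    code: "code ` ?E = {i. i < s}" "inj_on code ?E"
    using finite_imp_inj_to_nat_seg by metis
  obtain A B where AB: "finite A" "finite B"
    "\<And>\<beta>. \<beta> \<in> B \<Longrightarrow> finite \<beta> \<and> \<beta> \<noteq> {} \<and> \<beta> \<subseteq> {n..}"
    "\<And>\<chi>::int \<Rightarrow> nat. range \<chi> \<subseteq> {..<s} \<Longrightarrow> \<exists>a\<in>A. \<exists>\<beta>\<in>B. \<forall>v\<in>V. \<chi> (a + v \<beta>) = \<chi> a"
    by (rule recurrentE[OF assms(1), where r = s]) (rule that)
  have "\<exists>a\<in>A. \<exists>\<beta>\<in>B. \<forall>v\<in>V. \<forall>t\<in>T. \<chi> (a + v \<beta> + t) = \<chi> (a + t)"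
    if \<chi>: "range \<chi> \<subseteq> {..<r}" for \<chi> :: "int \<Rightarrow> nat"
  proof -
    define pat where "pat x = (\<lambda>t\<in>T. \<chi> (x + t))" for x
    have pat: "pat x \<in> ?E" for x
      using \<chi> by (auto simp: pat_def)
    have "range (\<lambda>x. code (pat x)) \<subseteq> {..<s}"
      using code(1) pat by blast
    from AB(4)[OF this] obtain a \<beta> where "a \<in> A" "\<beta> \<in> B"
      and eq: "\<forall>v\<in>V. code (pat (a + v \<beta>)) = code (pat a)"
      by blast
    moreover have "\<chi> (a + v \<beta> + t) = \<chi> (a + t)" if "v \<in> V" "t \<in> T" for v t
    proof -
      have "pat (a + v \<beta>) = pat a"
        using inj_onD[OF code(2) _ pat pat] eq that by blast
      then have "pat (a + v \<beta>) t = pat a t"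
        by simp
      then show ?thesis
        using that by (simp add: pat_def)
    qed
    ultimately show ?thesis by blast
  qed
  with AB show thesis
    using that[of A B] by blast
qed

section \<open>Colour focusing\<close>

text \<open>Suppose \<open>a\<close> is focused after translation by \<open>b\<close>, and patterns
  recur at \<open>b\<close> along \<open>\<beta>\<close> for the derived maps \<open>w\<close>. With
  \<open>a' = a + b - u \<beta>\<close> one has \<open>a' + v (\<beta> \<union> \<gamma>) = b + w
  \<beta> + (a + v \<gamma>)\<close>. So every focused colour survives at \<open>a'\<close>, and
  \<open>\<gamma> = {}\<close> adds the colour of \<open>a + b\<close>.\<close>

lemma recurrent_step:
  fixes V :: "(nat set \<Rightarrow> int) set"
  assumes fin: "finite V" and V0: "\<And>v. v \<in> V \<Longrightarrow> v {} = 0"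
    and rec: "\<And>m C. n \<le> m \<Longrightarrow> finite C \<Longrightarrow> (\<And>\<gamma>. \<gamma> \<in> C \<Longrightarrow> \<gamma> \<subseteq> {n..<m}) \<Longrightarrow>
        recurrent ((\<lambda>(v, \<gamma>) \<alpha>. v (\<alpha> \<union> \<gamma>) - v \<gamma> - u \<alpha>) ` (V \<times> C)) m"
  shows "recurrent V n"
  unfolding recurrent_def
proof
  fix r
  let ?mono = "\<lambda>\<chi>::int \<Rightarrow> nat. \<lambda>a \<beta>. \<forall>v\<in>V. \<chi> (a + v \<beta>) = \<chi> a"
  \<comment> \<open>\<open>K\<close> is a set of \<open>k\<close> colours focused at \<open>a\<close>; at \<open>k = r\<close> no colour is left for \<open>a\<close>.\<close>
  let ?foc = "\<lambda>k A B (\<chi>::int \<Rightarrow> nat). \<exists>a\<in>A. \<exists>K. finite K \<and> K \<subseteq> {..<r} \<and> card K = k \<and> \<chi> a \<notin> K \<and>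
      (\<forall>c\<in>K. \<exists>\<beta>\<in>B. \<forall>v\<in>V. \<chi> (a + v \<beta>) = c)"
  let ?ok = "\<lambda>A B. finite A \<and> finite B \<and> (\<forall>\<beta>\<in>B. finite \<beta> \<and> \<beta> \<noteq> {} \<and> \<beta> \<subseteq> {n..})"
  have focus: "\<exists>A B. ?ok A B \<and> (\<forall>\<chi>::int \<Rightarrow> nat. range \<chi> \<subseteq> {..<r} \<longrightarrow>
      (\<exists>a\<in>A. \<exists>\<beta>\<in>B. ?mono \<chi> a \<beta>) \<or> ?foc k A B \<chi>)" for k
  proof (induction k)
    case 0
    show ?case
      \<comment> \<open>With no colours to focus, \<open>K = {}\<close> works at the point
        0.\<close>
      by (rule exI[of _ "{0}"], rule exI[of _ "{}"]) auto
  next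
    case (Suc k)
    then obtain A B where ok: "?ok A B" and AB: "\<And>\<chi>::int \<Rightarrow> nat. range \<chi> \<subseteq> {..<r} \<Longrightarrow>
      (\<exists>a\<in>A. \<exists>\<beta>\<in>B. ?mono \<chi> a \<beta>) \<or> ?foc k A B \<chi>"
      by blast
    have "finite (\<Union>B)"
      using ok by blast
    then obtain m0 where m0: "\<Union>B \<subseteq> {..<m0}"
      using finite_nat_iff_bounded by blast
    \<comment> \<open>The next \<open>\<beta>\<close> are taken from \<open>{m..}\<close>, beyond
      every \<open>\<gamma>\<close> in \<open>B\<close>.\<close>
    define m where "m = max n m0"
    \<comment> \<open>Members of \<open>B\<close> carry over the old colours; \<open>{}\<close>
      accounts for the new one.\<close>
    define C where "C = insert {} B"
    have C: "finite C" "\<And>\<gamma>. \<gamma> \<in> C \<Longrightarrow> \<gamma> \<subseteq> {n..<m}"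
      using ok m0 by (fastforce simp: C_def m_def)+
    \<comment> \<open>All candidate focus points and all points they are compared with: a pattern on
      \<open>b + T\<close> records every colour that matters.\<close>
    define T where "T = A \<union> (\<lambda>(a, v, \<beta>). a + v \<beta>) ` (A \<times> V \<times> B)"
    have T: "finite T"
      using ok fin by (auto simp: T_def)
    have "recurrent ((\<lambda>(v, \<gamma>) \<alpha>. v (\<alpha> \<union> \<gamma>) - v \<gamma> - u \<alpha>) ` (V \<times> C)) m"
      using C by (intro rec) (auto simp: m_def)
    then obtain A' B' where
      A'B': "finite A'" "finite B'" "\<And>\<beta>. \<beta> \<in> B' \<Longrightarrow> finite \<beta> \<and> \<beta> \<noteq> {} \<and> \<beta> \<subseteq> {m..}"
        and pat: "\<And>\<chi>::int \<Rightarrow> nat. range \<chi> \<subseteq> {..<r} \<Longrightarrow> \<exists>b\<in>A'. \<exists>\<beta>\<in>B'.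
          \<forall>w\<in>(\<lambda>(v, \<gamma>) \<alpha>. v (\<alpha> \<union> \<gamma>) - v \<gamma> - u \<alpha>) ` (V \<times> C). \<forall>t\<in>T. \<chi> (b + w \<beta> + t) = \<chi> (b + t)"
      by (rule recurrent_patterns[OF _ T, where r = r]) (rule that)
    \<comment> \<open>The points \<open>a + b\<close> serve when a monochromatic configuration
      exists already; the points \<open>a + b - u \<beta>\<close> are the new focus points.\<close>
    define A2 where "A2 = (\<lambda>(a, b). a + b) ` (A \<times> A')
        \<union> (\<lambda>(a, b, \<beta>). a + b - u \<beta>) ` (A \<times> A' \<times> B')"
    define B2 where "B2 = B \<union> B' \<union> (\<lambda>(\<gamma>, \<beta>). \<gamma> \<union> \<beta>) ` (B \<times> B')"
    have fin2: "finite A2" "finite B2"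
      using ok A'B' by (auto simp: A2_def B2_def)
    have B'n: "\<beta> \<subseteq> {n..}" if "\<beta> \<in> B'" for \<beta>
      using A'B'(3)[OF that] by (auto simp: m_def)
    have "?ok A2 B2"
      using fin2 ok A'B'(3) B'n unfolding B2_def by auto
    moreover have "(\<exists>a\<in>A2. \<exists>\<beta>\<in>B2. ?mono \<chi> a \<beta>) \<or> ?foc (Suc k) A2 B2 \<chi>"
      if \<chi>: "range \<chi> \<subseteq> {..<r}" for \<chi> :: "int \<Rightarrow> nat"
    proof -
      from pat[OF \<chi>] obtain b \<beta> where b: "b \<in> A'" and \<beta>: "\<beta> \<in> B'"
        and eq0: "\<forall>w\<in>(\<lambda>(v, \<gamma>) \<alpha>. v (\<alpha> \<union> \<gamma>) - v \<gamma> - u \<alpha>) ` (V \<times> C). \<forall>t\<in>T. \<chi> (b + w \<beta> + t) = \<chi> (b + t)"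
        by blast
      have eq: "\<chi> (b + (v (\<beta> \<union> \<gamma>) - v \<gamma> - u \<beta>) + t) = \<chi> (b + t)"
        if "v \<in> V" "\<gamma> \<in> C" "t \<in> T" for v \<gamma> t
        using eq0 that by fastforce
      have "range (\<lambda>x. \<chi> (x + b)) \<subseteq> {..<r}"
        using \<chi> by auto
      from AB[OF this] consider
          (mono) a \<gamma> where "a \<in> A" "\<gamma> \<in> B" "\<forall>v\<in>V. \<chi> (a + v \<gamma> + b) = \<chi> (a + b)"
        | (foc) a K where "a \<in> A" "finite K" "K \<subseteq> {..<r}" "card K = k" "\<chi> (a + b) \<notin> K"
            "\<forall>c\<in>K. \<exists>\<gamma>\<in>B. \<forall>v\<in>V. \<chi> (a + v \<gamma> + b) = c"
        by blast
      then show ?thesis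
      proof cases
        case mono
        have "a + b \<in> A2" "\<gamma> \<in> B2"
          using mono b by (auto simp: A2_def B2_def)
        moreover have "?mono \<chi> (a + b) \<gamma>"
          using mono(3) by (simp add: algebra_simps)
        ultimately show ?thesis by blast
      next
        case foc
        define a' where "a' = a + b - u \<beta>"
        define K' where "K' = insert (\<chi> (a + b)) K"
        have a': "a' \<in> A2"
          using foc b \<beta> by (force simp: A2_def a'_def)
        have K': "finite K'" "K' \<subseteq> {..<r}" "card K' = Suc k"
          using foc(2-5) subsetD[OF \<chi> rangeI, of "a + b"] by (auto simp: K'_def)
        have foc': "\<exists>\<gamma>\<in>B2. \<forall>v\<in>V. \<chi> (a' + v \<gamma>) = c" if "c \<in> K'" for c
        proof (cases "c \<in> K")
          case True
          then obtain \<gamma> where \<gamma>: "\<gamma> \<in> B" "\<forall>v\<in>V. \<chi> (a + v \<gamma> + b) = c"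
            using foc(6) by blast
          have "\<beta> \<union> \<gamma> \<in> B2"
            using \<gamma> \<beta> by (force simp: B2_def)
          moreover have "\<chi> (a' + v (\<beta> \<union> \<gamma>)) = c" if "v \<in> V" for v
          proof -
            have "a + v \<gamma> \<in> T"
              using foc \<gamma> that by (force simp: T_def)
            from eq[OF that _ this, of \<gamma>] \<gamma> show ?thesis
              using that by (simp add: C_def a'_def algebra_simps)
          qed
          ultimately show ?thesis by blast
        next
          case False
          then have c: "c = \<chi> (a + b)"
            using that by (simp add: K'_def)
          have "\<chi> (a' + v \<beta>) = c" if "v \<in> V" for v
          proof -
            have "a \<in> T"
              using foc by (simp add: T_def)
            from eq[OF that _ this, of "{}"] show ?thesis
              using V0[OF that] by (simp add: C_def a'_def c algebra_simps)
          qed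
          moreover have "\<beta> \<in> B2"
            using \<beta> by (simp add: B2_def)
          ultimately show ?thesis by blast
        qed
        \<comment> \<open>If \<open>a'\<close> itself has a focused colour, the set belonging to
          that colour gives a monochromatic configuration; otherwise \<open>Suc k\<close> colours
          are focused at \<open>a'\<close>.\<close>
        show ?thesis
        proof (cases "\<chi> a' \<in> K'")
          case True
          then show ?thesis
            using foc' a' by blast
        next
          case False
          then show ?thesis
            using foc' a' K' by blast
        qed
      qed
    qed
    ultimately show ?case by blast
  qed
  have no_foc: "\<not> ?foc r A B \<chi>" if "range \<chi> \<subseteq> {..<r}" for A B \<chi>
  proof
    assume "?foc r A B \<chi>"
    then obtain a K where "K \<subseteq> {..<r}" "card K = r" "\<chi> a \<notin> K"
      by blast
    then have "K = {..<r}"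
      by (intro card_subset_eq) auto
    then show False
      using \<open>\<chi> a \<notin> K\<close> that by auto
  qed
  have "\<exists>A B. ?ok A B \<and> (\<forall>\<chi>::int \<Rightarrow> nat. range \<chi> \<subseteq> {..<r} \<longrightarrow>
      (\<exists>a\<in>A. \<exists>\<beta>\<in>B. ?mono \<chi> a \<beta>))"
    using focus[of r] by (simp only: no_foc simp_thms cong: imp_cong)
  then show "\<exists>A B. finite A \<and> finite B \<and> (\<forall>\<beta>\<in>B. finite \<beta> \<and> \<beta> \<noteq> {} \<and> \<beta> \<subseteq> {n..}) \<and>
        (\<forall>\<chi>::int \<Rightarrow> nat. range \<chi> \<subseteq> {..<r} \<longrightarrow> (\<exists>a\<in>A. \<exists>\<beta>\<in>B. ?mono \<chi> a \<beta>))"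
    by (simp only: conj_assoc)
qed

section \<open>Descent on the degrees of leading parts\<close>

text \<open>Maps of degree 0 vanish at every \<open>\<beta>\<close> from \<open>B\<close>, so they
  impose no condition on the colouring. Dropping them leaves only maps that have a leading part in
  the descent.\<close>

lemma recurrent_drop_zero:
  assumes "recurrent {v \<in> V. \<not> poly_map 0 n v} n"
  shows "recurrent V n"
  unfolding recurrent_def
proof
  fix r
  obtain A B where AB: "finite A" "finite B"
    "\<And>\<beta>. \<beta> \<in> B \<Longrightarrow> finite \<beta> \<and> \<beta> \<noteq> {} \<and> \<beta> \<subseteq> {n..}"
    "\<And>\<chi>::int \<Rightarrow> nat. range \<chi> \<subseteq> {..<r} \<Longrightarrow>
       \<exists>a\<in>A. \<exists>\<beta>\<in>B. \<forall>v\<in>{v \<in> V. \<not> poly_map 0 n v}. \<chi> (a + v \<beta>) = \<chi> a"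
    by (rule recurrentE[OF assms, where r = r]) (rule that)
  have "\<exists>a\<in>A. \<exists>\<beta>\<in>B. \<forall>v\<in>V. \<chi> (a + v \<beta>) = \<chi> a"
    if \<chi>: "range \<chi> \<subseteq> {..<r}" for \<chi> :: "int \<Rightarrow> nat"
  proof -
    obtain a \<beta> where a: "a \<in> A" "\<beta> \<in> B"
      and eq: "\<forall>v\<in>{v \<in> V. \<not> poly_map 0 n v}. \<chi> (a + v \<beta>) = \<chi> a"
      using AB(4)[OF \<chi>] by blast
    have "\<chi> (a + v \<beta>) = \<chi> a" if "v \<in> V" for v
    proof (cases "poly_map 0 n v")
      case True
      then show ?thesis
        using AB(3)[OF a(2)] by simp
    next
      case False
      then show ?thesis
        using eq that by blast
    qed
    then show ?thesis
      using a by blast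
  qed
  with AB show "\<exists>A B. finite A \<and> finite B \<and> (\<forall>\<beta>\<in>B. finite \<beta> \<and> \<beta> \<noteq> {} \<and> \<beta> \<subseteq> {n..}) \<and>
        (\<forall>\<chi>::int \<Rightarrow> nat. range \<chi> \<subseteq> {..<r} \<longrightarrow> (\<exists>a\<in>A. \<exists>\<beta>\<in>B. \<forall>v\<in>V. \<chi> (a + v \<beta>) = \<chi> a))"
    by blast
qed

text \<open>A pair \<open>(k, u)\<close> in \<open>Q\<close> stands for a possible leading part \<open>u\<close> of degree \<open>k + 1\<close>.\<close>

lemma recurrent_dominated:
  fixes Q :: "(nat \<times> (nat set \<Rightarrow> int)) multiset"
  assumes "finite V" "\<And>k u. (k, u) \<in># Q \<Longrightarrow> poly_map (Suc k) n u"
    and "\<And>v. v \<in> V \<Longrightarrow> poly_map 0 n v \<or> (\<exists>(k, u) \<in> set_mset Q. poly_map k n (\<lambda>\<alpha>. v \<alpha> - u \<alpha>))"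
  shows "recurrent V n"
  using assms
\<comment> \<open>The induction is on the multiset of first components, which drops when one entry
  is replaced by finitely many smaller ones.\<close>
proof (induction Q arbitrary: V n rule: wf_induct_rule[OF wf_inv_image[OF wf_mult1[OF wf_less_than],
        of "image_mset fst"]])
  case (1 Q)
  note poly_map.simps [simp del]
  define W where "W = {v \<in> V. \<not> poly_map 0 n v}"
  have W: "finite W" "\<And>v. v \<in> W \<Longrightarrow> \<exists>(k, u) \<in> set_mset Q. poly_map k n (\<lambda>\<alpha>. v \<alpha> - u \<alpha>)"
    using 1(2,4) by (auto simp: W_def)
  have "recurrent W n"
  proof (cases "Q = {#}")
    case True
    then have "W = {}"
      using W(2) by auto
    then show ?thesis
      \<comment> \<open>With no maps left, any point and any nonempty index set will do.\<close>
      unfolding recurrent_def by (intro allI exI[of _ "{0}"] exI[of _ "{{n}}"]) auto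
  next
    case False
    \<comment> \<open>Minimality ensures that subtracting \<open>u\<close> leaves the leading parts
      of higher degree intact.\<close>
    then obtain iu where iu: "iu \<in># Q" and min: "\<And>q. q \<in># Q \<Longrightarrow> fst iu \<le> fst q"
      using ex_min_if_finite[of "fst ` set_mset Q"] by (auto simp: not_less)
    obtain i u where iu_eq: "iu = (i, u)"
      by (cases iu)
    obtain Q0 where Q: "Q = add_mset (i, u) Q0"
      using iu iu_eq by (metis multi_member_split)
    have Q0: "i \<le> j" "poly_map (Suc j) n u'" if "(j, u') \<in># Q0" for j u'
      using min[of "(j, u')"] 1(3)[of j u'] that by (auto simp: Q iu_eq)
    have u: "poly_map (Suc i) n u"
      using 1(3) by (simp add: Q)
    have W': "\<exists>k u'. (k, u') \<in># Q \<and> i \<le> k \<and> poly_map k n (\<lambda>\<alpha>. v \<alpha> - u' \<alpha>) \<and> poly_map (Suc k) n v"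
      if "v \<in> W" for v
    proof -
      obtain k u' where ku: "(k, u') \<in># Q" "poly_map k n (\<lambda>\<alpha>. v \<alpha> - u' \<alpha>)"
        using W(2)[OF \<open>v \<in> W\<close>] by auto
      have "poly_map (Suc k) n (\<lambda>\<alpha>. (v \<alpha> - u' \<alpha>) + u' \<alpha>)"
        using poly_map_add[OF poly_map_Suc[OF ku(2)] 1(3)[OF ku(1)]] .
      moreover have "i \<le> k"
        using min[OF ku(1)] by (simp add: iu_eq)
      ultimately show ?thesis
        using ku by auto
    qed
    show ?thesis
    proof (rule recurrent_step[where u = u])
      show "finite W" by fact
      show "v {} = 0" if "v \<in> W" for v
        using W'[OF that] poly_map_empty by blast
      fix m and C :: "nat set set"
      assume m: "n \<le> m" and C: "finite C" "\<And>\<gamma>. \<gamma> \<in> C \<Longrightarrow> \<gamma> \<subseteq> {n..<m}"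
      define V' where "V' = (\<lambda>(v, \<gamma>) \<alpha>. v (\<alpha> \<union> \<gamma>) - v \<gamma> - u \<alpha>) ` (W \<times> C)"
      \<comment> \<open>The other leading parts keep their indices: those with index
        \<open>i\<close> change by \<open>- u\<close>, the higher ones stay.\<close>
      define Q1 where "Q1 = image_mset (\<lambda>(j, u'). if j = i then (i, \<lambda>\<alpha>. u' \<alpha> - u \<alpha>) else (j, u')) Q0"
      \<comment> \<open>Maps led by \<open>u\<close> drop to degree at most \<open>i\<close> and
        become their own leading parts, with index \<open>i - 1\<close>. For \<open>i = 0\<close>
        they vanish on the tail and have none.\<close>
      define Q2 where "Q2 = (if i = 0 then {#} else image_mset (Pair (i - 1)) (mset_set {w \<in> V'. poly_map i m w}))"
      have V': "finite V'"
        using W C by (simp add: V'_def)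
      have fst_Q1: "image_mset fst Q1 = image_mset fst Q0"
        by (auto simp: Q1_def multiset.map_comp intro!: image_mset_cong)
      have "(image_mset fst (Q1 + Q2), image_mset fst Q) \<in> mult1 less_than"
      proof (rule mult1I)
        show "image_mset fst Q = add_mset i (image_mset fst Q0)"
          by (simp add: Q)
        show "image_mset fst (Q1 + Q2) = image_mset fst Q0 + image_mset fst Q2"
          by (simp add: fst_Q1)
        show "(b, i) \<in> less_than" if "b \<in># image_mset fst Q2" for b
          using that by (auto simp: Q2_def split: if_splits)
      qed
      then have "(Q1 + Q2, Q) \<in> inv_image (mult1 less_than) (image_mset fst)"
        by simp
      then show "recurrent V' m"
      proof (rule 1(1))
        show "finite V'" by fact
      next
        fix k w assume "(k, w) \<in># Q1 + Q2"
        then consider (1) "(k, w) \<in># Q1" | (2) "(k, w) \<in># Q2"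
          by auto
        then show "poly_map (Suc k) m w"
        proof cases
          case 1
          then obtain j u' where ju: "(j, u') \<in># Q0"
            and kw: "(k, w) = (if j = i then (i, \<lambda>\<alpha>. u' \<alpha> - u \<alpha>) else (j, u'))"
            by (auto simp: Q1_def)
          then show ?thesis
            using Q0(2)[OF ju] u m by (auto intro!: poly_map_tail[OF _ m] poly_map_diff split: if_splits)
        next
          case 2
          then show ?thesis
            using V' by (auto simp: Q2_def split: if_splits)
        qed
      next
        fix w assume w: "w \<in> V'"
        then obtain v \<gamma> where v: "v \<in> W" "\<gamma> \<in> C" and w_eq: "w = (\<lambda>\<alpha>. v (\<alpha> \<union> \<gamma>) - v \<gamma> - u \<alpha>)"
          by (auto simp: V'_def)
        obtain k u' where ku: "(k, u') \<in># Q" "i \<le> k" "poly_map k n (\<lambda>\<alpha>. v \<alpha> - u' \<alpha>)"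
          "poly_map (Suc k) n v"
          using W'[OF v(1)] by blast
        \<comment> \<open>Here \<open>w = v + D - u\<close>, and \<open>D\<close> has degree at most
          \<open>k\<close>, like the error \<open>v - u'\<close>. So the shift by
          \<open>\<gamma>\<close> does not affect the leading part.\<close>
        define D where "D = (\<lambda>\<alpha>. v (\<alpha> \<union> \<gamma>) - v \<alpha> - v \<gamma>)"
        have D: "poly_map k m D"
          using ku(4) C(2)[OF v(2)] m unfolding D_def poly_map.simps by blast
        have vu': "poly_map k m (\<lambda>\<alpha>. (v \<alpha> - u' \<alpha>) + D \<alpha>)"
          using poly_map_add[OF poly_map_tail[OF ku(3) m] D] .
        consider (lead) "k = i" "u' = u" | (same) "k = i" "(k, u') \<in># Q0" | (high) "k > i" "(k, u') \<in># Q0"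
          using ku(1,2) by (cases "k = i") (auto simp: Q)
        then show "poly_map 0 m w \<or> (\<exists>(k, u) \<in> set_mset (Q1 + Q2). poly_map k m (\<lambda>\<alpha>. w \<alpha> - u \<alpha>))"
        proof cases
          case lead
          have "w = (\<lambda>\<alpha>. (v \<alpha> - u' \<alpha>) + D \<alpha>)"
            by (auto simp: w_eq D_def lead)
          with vu' have pw: "poly_map i m w"
            by (simp add: lead)
          show ?thesis
          proof (cases "i = 0")
            case False
            have "(i - 1, w) \<in># Q1 + Q2"
              using False V' w pw by (auto simp: Q2_def)
            moreover have "poly_map (i - 1) m (\<lambda>\<alpha>. w \<alpha> - w \<alpha>)"
              by (simp add: poly_map_zero)
            ultimately show ?thesis by blast
          qed (use pw in simp)
        next
          case same
          have "(k, \<lambda>\<alpha>. u' \<alpha> - u \<alpha>) \<in># Q1 + Q2"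
            using same by (force simp: Q1_def)
          moreover have "(\<lambda>\<alpha>. w \<alpha> - (u' \<alpha> - u \<alpha>)) = (\<lambda>\<alpha>. (v \<alpha> - u' \<alpha>) + D \<alpha>)"
            by (auto simp: w_eq D_def)
          ultimately show ?thesis
            using vu' by (intro disjI2 bexI[of _ "(k, \<lambda>\<alpha>. u' \<alpha> - u \<alpha>)"]) auto
        next
          case high
          have "(k, u') \<in># Q1 + Q2"
            using high by (force simp: Q1_def)
          \<comment> \<open>As \<open>Suc i \<le> k\<close>, the map \<open>u\<close> is absorbed
            into the error.\<close>
          moreover have "poly_map k m (\<lambda>\<alpha>. ((v \<alpha> - u' \<alpha>) + D \<alpha>) - u \<alpha>)"
            using poly_map_diff[OF vu' poly_map_mono[OF poly_map_tail[OF u m]]] high by simp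
          moreover have "(\<lambda>\<alpha>. ((v \<alpha> - u' \<alpha>) + D \<alpha>) - u \<alpha>) = (\<lambda>\<alpha>. w \<alpha> - u' \<alpha>)"
            by (auto simp: w_eq D_def)
          ultimately show ?thesis
            by (intro disjI2 bexI[of _ "(k, u')"]) auto
        qed
      qed
    qed
  qed
  then show ?case
    unfolding W_def by (rule recurrent_drop_zero)
qed

text \<open>Each map is taken as its own leading part with index \<open>d\<close>, which leaves the
  error 0.\<close>

theorem recurrent_poly_map:
  assumes "finite V" "\<And>v. v \<in> V \<Longrightarrow> poly_map d n v"
  shows "recurrent V n"
proof (rule recurrent_dominated[where Q = "image_mset (Pair d) (mset_set V)"])
  fix v assume "v \<in> V"
  have "poly_map d n (\<lambda>\<alpha>. v \<alpha> - v \<alpha>)"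
    by (simp add: poly_map_zero del: poly_map.simps)
  then show "poly_map 0 n v \<or>
      (\<exists>(k, u) \<in> set_mset (image_mset (Pair d) (mset_set V)). poly_map k n (\<lambda>\<alpha>. v \<alpha> - u \<alpha>))"
    using assms(1) \<open>v \<in> V\<close> by (intro disjI2 bexI[of _ "(d, v)"]) auto
next
  fix k u assume "(k, u) \<in># image_mset (Pair d) (mset_set V)"
  then show "poly_map (Suc k) n u"
    using assms by (auto simp del: poly_map.simps intro: poly_map_Suc)
qed fact

section \<open>Partition regularity of the positive integers\<close>

text \<open>Each class comes with polynomials and IP-sets witnessing that it is not a
  \<open>Jp_set\<close>. Recurrence for all these witnesses at once, applied to the colouring by
  covering classes, puts a configuration into one class and contradicts the witness of that
  class.\<close>

lemma not_covered_by_non_Jp_sets: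
  assumes "finite G" "\<And>A. A \<in> G \<Longrightarrow> A \<subseteq> pnat \<and> \<not> Jp_set A"
  shows "\<not> pnat \<subseteq> \<Union>G"
proof
  assume cov: "pnat \<subseteq> \<Union>G"
  define D where "D F l X \<longleftrightarrow> finite F \<and> F \<subseteq> PP \<and> l \<in> pnat \<and> (\<forall>i\<in>{1..l}. IP_set (X i))"
    for F l and X :: "nat \<Rightarrow> nat set \<Rightarrow> nat"
  define S where "S A F l X \<longleftrightarrow> (\<exists>a::nat. \<exists>\<beta>\<in>fin_index_sets. \<forall>P\<in>F. \<forall>i\<in>{1..l}.
      int a + poly P (int (X i \<beta>)) \<in> int ` A)" for A F and l :: nat and X
  have "Jp_set A \<longleftrightarrow> A \<subseteq> pnat \<and> (\<forall>F l X. D F l X \<longrightarrow> S A F l X)" for A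
    by (simp only: Jp_set_def D_def S_def)
  then have "\<forall>A\<in>G. \<exists>F l X. D F l X \<and> \<not> S A F l X"
    using assms(2) by blast
  then obtain F l X where DS: "\<And>A. A \<in> G \<Longrightarrow> D (F A) (l A) (X A)"
      "\<And>A. A \<in> G \<Longrightarrow> \<not> S A (F A) (l A) (X A)"
    by metis
  have FlX: "\<And>A. A \<in> G \<Longrightarrow> finite (F A)" "\<And>A. A \<in> G \<Longrightarrow> F A \<subseteq> PP"
      "\<And>A i. A \<in> G \<Longrightarrow> i \<in> {1..l A} \<Longrightarrow> IP_set (X A i)"
    and no: "\<And>A a \<beta>. A \<in> G \<Longrightarrow> \<beta> \<in> fin_index_sets \<Longrightarrow>
        \<not> (\<forall>P\<in>F A. \<forall>i\<in>{1..l A}. int a + poly P (int (X A i \<beta>)) \<in> int ` A)"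
    using DS unfolding D_def S_def by blast+
  have "\<forall>A\<in>G. \<forall>i\<in>{1..l A}. \<exists>x. \<forall>\<alpha>\<in>fin_index_sets. X A i \<alpha> = (\<Sum>t\<in>\<alpha>. x t)"
    using FlX(3) unfolding IP_set_def by meson
  then obtain x where x: "\<And>A i \<alpha>. A \<in> G \<Longrightarrow> i \<in> {1..l A} \<Longrightarrow> \<alpha> \<in> fin_index_sets \<Longrightarrow>
      X A i \<alpha> = (\<Sum>t\<in>\<alpha>. x A i t)"
    by metis
  define v where "v A i P = (\<lambda>\<alpha>. poly P (\<Sum>t\<in>\<alpha>. int (x A i t)))" for A i P
  \<comment> \<open>The witnesses of all classes are pooled, as the class found by recurrence is not
    known in advance.\<close>
  define V where "V = (\<Union>A\<in>G. \<Union>i\<in>{1..l A}. v A i ` F A)"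
  have finV: "finite V"
    using assms(1) FlX(1) by (auto simp: V_def)
  define d where "d = Max (insert 0 (degree ` (\<Union>A\<in>G. F A)))"
  have "poly_map d 1 w" if w_in: "w \<in> V" for w
  proof -
    obtain A i P where w: "A \<in> G" "P \<in> F A" "w = v A i P"
      using w_in by (auto simp: V_def)
    have "degree P \<le> d"
      unfolding d_def using assms(1) FlX(1) w by (intro Max_ge) auto
    moreover have "poly P 0 = 0"
      using FlX(2) w by (auto simp: PP_def)
    ultimately show ?thesis
      unfolding w(3) v_def by (rule poly_map_poly_sum)
  qed
  with finV have rec: "recurrent V 1"
    by (rule recurrent_poly_map)
  obtain code :: "nat set \<Rightarrow> nat" and r where code: "code ` G = {i. i < r}" "inj_on code G"
    using finite_imp_inj_to_nat_seg[OF assms(1)] by metis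
  obtain A B where fin: "finite A" "finite B"
    and B: "\<And>\<beta>. \<beta> \<in> B \<Longrightarrow> finite \<beta> \<and> \<beta> \<noteq> {} \<and> \<beta> \<subseteq> {1..}"
    and AB: "\<And>\<chi>::int \<Rightarrow> nat. range \<chi> \<subseteq> {..<r} \<Longrightarrow> \<exists>a\<in>A. \<exists>\<beta>\<in>B. \<forall>v\<in>V. \<chi> (a + v \<beta>) = \<chi> a"
    by (rule recurrentE[OF rec, where r = r]) (rule that)
  \<comment> \<open>The finite window of all integers whose colours are compared; translation by
    \<open>K\<close> makes it positive.\<close>
  define Z where "Z = A \<union> (\<lambda>(a, w, \<beta>). a + w \<beta>) ` (A \<times> V \<times> B)"
  have "finite Z"
    using fin finV by (auto simp: Z_def)
  define K where "K = 1 - Min (insert 0 Z)"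
  have K: "z + K \<ge> 1" if "z \<in> Z" for z
  proof -
    have "Min (insert 0 Z) \<le> z"
      using that \<open>finite Z\<close> by (intro Min_le) auto
    then show ?thesis
      unfolding K_def by linarith
  qed
  \<comment> \<open>The \<open>max\<close> only makes the colouring total; on \<open>Z\<close> it
    has no effect because \<open>z + K\<close> is at least 1 there.\<close>
  define h where "h z = (SOME S. S \<in> G \<and> nat (max 1 (z + K)) \<in> S)" for z
  have h: "h z \<in> G \<and> nat (max 1 (z + K)) \<in> h z" for z
  proof -
    have "nat (max 1 (z + K)) \<in> pnat"
      by (auto simp: pnat_def)
    then have "\<exists>S. S \<in> G \<and> nat (max 1 (z + K)) \<in> S"
      using cov by blast
    then show ?thesis
      unfolding h_def by (rule someI_ex)
  qed
  have "range (\<lambda>z. code (h z)) \<subseteq> {..<r}"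
    using h code(1) by blast
  from AB[OF this] obtain a \<beta> where a: "a \<in> A" "\<beta> \<in> B"
    and eq: "\<forall>w\<in>V. code (h (a + w \<beta>)) = code (h a)"
    by blast
  have \<beta>: "\<beta> \<in> fin_index_sets"
    using B[OF a(2)] by (auto simp: fin_index_sets_def pnat_def)
  have Ka: "a + K \<ge> 1"
    using K a by (simp add: Z_def)
  have "int (nat (a + K)) + poly P (int (X (h a) i \<beta>)) \<in> int ` h a"
    if P: "P \<in> F (h a)" and i: "i \<in> {1..l (h a)}" for P i
  proof -
    let ?w = "v (h a) i P"
    have w: "?w \<in> V"
      unfolding V_def using h[of a] i P by blast
    have "h (a + ?w \<beta>) = h a"
      using inj_onD[OF code(2)] eq w h by blast
    moreover have "a + ?w \<beta> \<in> Z"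
      using a w by (force simp: Z_def)
    ultimately have "nat (a + ?w \<beta> + K) \<in> h a" "a + ?w \<beta> + K \<ge> 1"
      using h[of "a + ?w \<beta>"] K[of "a + ?w \<beta>"] by auto
    then have "a + ?w \<beta> + K \<in> int ` h a"
      by force
    moreover have "poly P (int (X (h a) i \<beta>)) = ?w \<beta>"
      using x[OF _ i \<beta>] h by (simp add: v_def)
    ultimately show ?thesis
      using Ka by (simp add: algebra_simps)
  qed
  with no[OF _ \<beta>, of "h a" "nat (a + K)"] h show False
    by blast
qed

section \<open>Ultrafilters\<close>

text \<open>By Zorn's lemma there is a maximal family with the finite intersection property.
  Intersecting with \<open>X\<close> gives the right meaning to an empty \<open>H\<close>.\<close>

lemma ultrafilter_extending:
  assumes "\<S> \<subseteq> Pow X" and fip: "\<And>H. finite H \<Longrightarrow> H \<subseteq> \<S> \<Longrightarrow> X \<inter> \<Inter>H \<noteq> {}"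
  obtains U where "ultrafilter_on X U" "\<S> \<subseteq> U"
proof -
  define \<F> where "\<F> = {U. \<S> \<subseteq> U \<and> U \<subseteq> Pow X \<and> (\<forall>H. finite H \<and> H \<subseteq> U \<longrightarrow> X \<inter> \<Inter>H \<noteq> {})}"
  have "\<S> \<in> \<F>"
    using assms by (auto simp: \<F>_def)
  have "\<exists>U\<in>\<F>. \<forall>Y\<in>\<F>. U \<subseteq> Y \<longrightarrow> Y = U"
  proof (rule subset_Zorn_nonempty)
    show "\<F> \<noteq> {}"
      using \<open>\<S> \<in> \<F>\<close> by blast
    fix \<C> assume \<C>: "\<C> \<noteq> {}" "subset.chain \<F> \<C>"
    have sub: "\<C> \<subseteq> \<F>"
      using \<C>(2) by (simp add: subset.chain_def)
    have "X \<inter> \<Inter>H \<noteq> {}" if H: "finite H" "H \<subseteq> \<Union>\<C>" for H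
    proof -
      obtain Y where "Y \<in> \<C>" "H \<subseteq> Y"
        using finite_subset_Union_chain[OF H \<C>] by blast
      then show ?thesis
        using sub H(1) by (auto simp: \<F>_def)
    qed
    moreover have "\<S> \<subseteq> Y \<and> Y \<subseteq> Pow X" if "Y \<in> \<C>" for Y
      using sub that by (auto simp: \<F>_def)
    then have "\<S> \<subseteq> \<Union>\<C> \<and> \<Union>\<C> \<subseteq> Pow X"
      using \<C>(1) by blast
    ultimately show "\<Union>\<C> \<in> \<F>"
      by (simp add: \<F>_def)
  qed
  then obtain U where U: "U \<in> \<F>" and max: "\<And>Y. Y \<in> \<F> \<Longrightarrow> U \<subseteq> Y \<Longrightarrow> Y = U"
    by blast
  have UF: "\<S> \<subseteq> U" "U \<subseteq> Pow X" "\<And>H. finite H \<Longrightarrow> H \<subseteq> U \<Longrightarrow> X \<inter> \<Inter>H \<noteq> {}"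
    using U by (auto simp: \<F>_def)
  \<comment> \<open>By maximality, a set that can be adjoined without losing the finite intersection
    property is already a member. The closure properties and the dichotomy follow from this.\<close>
  have memI: "A \<in> U" if "A \<subseteq> X" "\<And>H. finite H \<Longrightarrow> H \<subseteq> U \<Longrightarrow> A \<inter> \<Inter>H \<noteq> {}" for A
  proof -
    have "X \<inter> \<Inter>H \<noteq> {}" if "finite H" "H \<subseteq> insert A U" for H
    proof -
      have "A \<inter> \<Inter>(H - {A}) \<noteq> {}"
        using that by (intro \<open>\<And>H. finite H \<Longrightarrow> H \<subseteq> U \<Longrightarrow> A \<inter> \<Inter>H \<noteq> {}\<close>) auto
      then show ?thesis
        using \<open>A \<subseteq> X\<close> by blast
    qed
    then have "insert A U \<in> \<F>"
      using UF that(1) by (auto simp: \<F>_def)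
    from max[OF this] show ?thesis
      by blast
  qed
  have X: "X \<in> U"
    using UF by (intro memI) auto
  have empty: "{} \<notin> U"
    using UF(3)[of "{{}}"] by auto
  have up: "B \<in> U" if "A \<in> U" "A \<subseteq> B" "B \<subseteq> X" for A B
  proof (rule memI[OF that(3)])
    fix H assume "finite H" "H \<subseteq> U"
    then have "X \<inter> \<Inter>(insert A H) \<noteq> {}"
      using that by (intro UF) auto
    then show "B \<inter> \<Inter>H \<noteq> {}"
      using that by blast
  qed
  have int: "A \<inter> B \<in> U" if "A \<in> U" "B \<in> U" for A B
  proof (rule memI)
    show "A \<inter> B \<subseteq> X"
      using that UF by blast
    fix H assume "finite H" "H \<subseteq> U"
    then have "X \<inter> \<Inter>(insert A (insert B H)) \<noteq> {}"
      using that by (intro UF) auto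
    then show "A \<inter> B \<inter> \<Inter>H \<noteq> {}"
      by blast
  qed
  have dich: "A \<in> U \<or> X - A \<in> U" if A: "A \<subseteq> X" for A
  proof (rule ccontr)
    assume neg: "\<not> (A \<in> U \<or> X - A \<in> U)"
    obtain H where H: "finite H" "H \<subseteq> U" "A \<inter> \<Inter>H = {}"
      using neg memI[OF A] by blast
    obtain H' where H': "finite H'" "H' \<subseteq> U" "(X - A) \<inter> \<Inter>H' = {}"
      using neg memI[of "X - A"] by blast
    have "X \<inter> \<Inter>(H \<union> H') \<noteq> {}"
      using H H' by (intro UF) auto
    then show False
      using H H' by blast
  qed
  have "ultrafilter_on X U"
    unfolding ultrafilter_on_def using UF(2) X empty up int dich by blast
  then show thesis
    using that UF(1) by blast
qed

lemma ultrafilter_on_Inter: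
  assumes U: "ultrafilter_on X U" and "finite H" "H \<subseteq> U"
  shows "X \<inter> \<Inter>H \<in> U"
  using assms(2,3)
proof (induction H)
  case empty
  then show ?case
    using U by (simp add: ultrafilter_on_def)
next
  case (insert A H)
  then have "A \<in> U" "X \<inter> \<Inter>H \<in> U"
    by auto
  then have "A \<inter> (X \<inter> \<Inter>H) \<in> U"
    using U unfolding ultrafilter_on_def by metis
  then show ?case
    by (simp add: Int_left_commute)
qed

lemma betaN_nonempty:
  assumes "p \<in> betaN" "A \<in> p"
  shows "\<exists>x\<in>pnat. x \<in> A"
proof -
  have "A \<noteq> {}" "A \<subseteq> pnat"
    using assms by (auto simp: betaN_def ultrafilter_on_def)
  then show ?thesis by blast
qed

section \<open>The ideal\<close>

text \<open>Since finitely many sets that are not \<open>Jp_set\<close>s never cover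
  \<open>pnat\<close>, their complements have the finite intersection property. An ultrafilter
  containing all these complements lies in \<open>Jp\<close>.\<close>

lemma Jp_nonempty: "Jp \<noteq> {}"
proof -
  define \<S> where "\<S> = {pnat - A | A. A \<subseteq> pnat \<and> \<not> Jp_set A}"
  have "pnat \<inter> \<Inter>H \<noteq> {}" if H: "finite H" "H \<subseteq> \<S>" for H
  proof -
    have "A \<subseteq> pnat \<and> \<not> Jp_set A" if "A \<in> (-) pnat ` H" for A
      using that H(2) by (auto simp: \<S>_def double_diff)
    then have "\<not> pnat \<subseteq> \<Union>((-) pnat ` H)"
      using H(1) by (intro not_covered_by_non_Jp_sets) auto
    then show ?thesis by blast
  qed
  moreover have "\<S> \<subseteq> Pow pnat"
    by (auto simp: \<S>_def)
  ultimately obtain U where U: "ultrafilter_on pnat U" "\<S> \<subseteq> U"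
    using ultrafilter_extending by metis
  have "Jp_set A" if "A \<in> U" for A
  proof (rule ccontr)
    assume "\<not> Jp_set A"
    have "A \<subseteq> pnat"
      using U that by (auto simp: ultrafilter_on_def)
    then have "pnat - A \<in> U"
      using U(2) \<open>\<not> Jp_set A\<close> by (auto simp: \<S>_def)
    then have "A \<inter> (pnat - A) \<in> U"
      using U(1) that unfolding ultrafilter_on_def by metis
    then show False
      using U(1) by (simp add: ultrafilter_on_def Diff_disjoint)
  qed
  then show ?thesis
    using U by (auto simp: Jp_def betaN_def)
qed

lemma Jp_setE:
  assumes "Jp_set A" "finite F \<and> F \<subseteq> PP \<and> l \<in> pnat \<and> (\<forall>i\<in>{1..l}. IP_set (X i))"
  obtains a :: nat and \<beta> where "\<beta> \<in> fin_index_sets"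
    "\<forall>P\<in>F. \<forall>i\<in>{1..l}. int a + poly P (int (X i \<beta>)) \<in> int ` A"
  using assms(1)[unfolded Jp_set_def, THEN conjunct2, rule_format, OF assms(2)] that by blast

text \<open>The translation by \<open>x\<close> is absorbed into the free shift: \<open>a\<close>
  becomes \<open>x + a\<close> while \<open>\<beta>\<close> stays.\<close>

lemma Jp_set_if_shift_back:
  assumes "Jp_set (shift_back x A)" "A \<subseteq> pnat"
  shows "Jp_set A"
  unfolding Jp_set_def
proof (intro conjI allI impI)
  show "A \<subseteq> pnat" by fact
  fix F l X
  assume "finite F \<and> F \<subseteq> PP \<and> l \<in> pnat \<and> (\<forall>i\<in>{1..l}. IP_set (X i))"
  then obtain a :: nat and \<beta> where \<beta>: "\<beta> \<in> fin_index_sets"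
    and a: "\<forall>P\<in>F. \<forall>i\<in>{1..l}. int a + poly P (int (X i \<beta>)) \<in> int ` shift_back x A"
    using Jp_setE[OF assms(1)] by metis
  have "int (x + a) + poly P (int (X i \<beta>)) \<in> int ` A" if Pi: "P \<in> F" "i \<in> {1..l}" for P i
  proof -
    obtain y where "int a + poly P (int (X i \<beta>)) = int y" "x + y \<in> A"
      using a Pi by (fastforce simp: shift_back_def)
    then show ?thesis
      by (intro image_eqI[of _ _ "x + y"]) auto
  qed
  with \<beta> show "\<exists>a::nat. \<exists>\<beta>\<in>fin_index_sets. \<forall>P\<in>F. \<forall>i\<in>{1..l}.
      int a + poly P (int (X i \<beta>)) \<in> int ` A"
    by blast
qed

text \<open>A single \<open>x\<close> with \<open>shift_back x A \<in> p\<close> suffices, and one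
  exists because members of \<open>s\<close> are nonempty.\<close>

lemma beta_add_Jp_right:
  assumes "s \<in> betaN" "p \<in> Jp"
  shows "beta_add s p \<in> Jp"
proof -
  have "Jp_set A" if A: "A \<in> beta_add s p" for A
  proof -
    obtain x where "shift_back x A \<in> p" "A \<subseteq> pnat"
      using A betaN_nonempty[OF assms(1)] by (fastforce simp: beta_add_def)
    then show ?thesis
      using assms(2) Jp_set_if_shift_back by (auto simp: Jp_def)
  qed
  moreover have "beta_add s p \<in> betaN"
    using assms by (intro beta_add_closed) (auto simp: Jp_def)
  ultimately show ?thesis
    by (simp add: Jp_def)
qed

text \<open>The \<open>Jp_set\<close> \<open>B\<close> contains a finite configuration. The sets
  \<open>shift_back z A\<close> for its points \<open>z\<close> all lie in \<open>s\<close>, hence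
  have a common element \<open>y\<close>, and adding \<open>y\<close> to the shift moves the
  configuration into \<open>A\<close>.\<close>

lemma beta_add_Jp_left:
  assumes "p \<in> Jp" "s \<in> betaN"
  shows "beta_add p s \<in> Jp"
proof -
  have "Jp_set A" if A: "A \<in> beta_add p s" for A
    unfolding Jp_set_def
  proof (intro conjI allI impI)
    show "A \<subseteq> pnat"
      using A by (simp add: beta_add_def)
    define B where "B = {x \<in> pnat. shift_back x A \<in> s}"
    have "Jp_set B"
      using A assms(1) by (simp add: beta_add_def Jp_def B_def)
    fix F and l :: nat and X
    assume FlX: "finite F \<and> F \<subseteq> PP \<and> l \<in> pnat \<and> (\<forall>i\<in>{1..l}. IP_set (X i))"
    then obtain a :: nat and \<beta> where \<beta>: "\<beta> \<in> fin_index_sets"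
      and a: "\<forall>P\<in>F. \<forall>i\<in>{1..l}. int a + poly P (int (X i \<beta>)) \<in> int ` B"
      using Jp_setE[OF \<open>Jp_set B\<close>] by metis
    let ?z = "\<lambda>P i. int a + poly P (int (X i \<beta>))"
    define H where "H = (\<lambda>(P, i). shift_back (nat (?z P i)) A) ` (F \<times> {1..l})"
    have "finite H"
      using FlX by (simp add: H_def)
    moreover have "H \<subseteq> s"
      using a by (fastforce simp: H_def B_def)
    ultimately have "pnat \<inter> \<Inter>H \<in> s"
      using assms(2) by (intro ultrafilter_on_Inter) (auto simp: betaN_def)
    then obtain y where y: "y \<in> \<Inter>H"
      using betaN_nonempty[OF assms(2)] by blast
    have "int (a + y) + poly P (int (X i \<beta>)) \<in> int ` A" if Pi: "P \<in> F" "i \<in> {1..l}" for P i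
    proof -
      have "shift_back (nat (?z P i)) A \<in> H"
        using Pi by (auto simp: H_def)
      then have "nat (?z P i) + y \<in> A"
        using y by (auto simp: shift_back_def)
      moreover have "?z P i \<ge> 0"
        using a Pi by force
      ultimately show ?thesis
        by (intro image_eqI[of _ _ "nat (?z P i) + y"]) auto
    qed
    with \<beta> show "\<exists>a::nat. \<exists>\<beta>\<in>fin_index_sets. \<forall>P\<in>F. \<forall>i\<in>{1..l}.
        int a + poly P (int (X i \<beta>)) \<in> int ` A"
      by blast
  qed
  moreover have "beta_add p s \<in> betaN"
    using assms by (intro beta_add_closed) (auto simp: Jp_def)
  ultimately show ?thesis
    by (simp add: Jp_def)
qed

theorem theorem2p8:
  shows "two_sided_ideal betaN beta_add Jp"
proof -
  have "Jp \<subseteq> betaN"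
    by (auto simp: Jp_def)
  then show ?thesis
    unfolding two_sided_ideal_def
    using Jp_nonempty beta_add_Jp_left beta_add_Jp_right by blast
qed

end
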